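(* For any $G\in C^\infty([0,1])$ and $\gamma\in(0,2)$, $$\lim_{N\to\infty}N^{-1}\sum_{x\in\Lambda_N}\left|N^\gamma(\mathcal L_NG)\left(\tfrac xN\right)-(\mathbb LG)\left(\tfrac xN\right)\right|=0.$$
   Context: $\Lambda_N=\{1,\dots,N-1\}$; $c_\gamma=\big(\sum_{z\in\mathbb Z\setminus\{0\}}|z|^{-\gamma-1}\big)^{-1}$; $p(z)=c_\gamma|z|^{-\gamma-1}$ for $z\in\mathbb Z\setminus\{0\}$ and $p(0)=0$. For $x\in\Lambda_N$, $$(\mathcal L_NG)\left(\tfrac xN\right)=\sum_{y\in\Lambda_N}p(y-x)\left[G\left(\tfrac yN\right)-G\left(\tfrac xN\right)\right].$$ $\mathbb L$ is the regional fractional Laplacian on $(0,1)$: $$(\mathbb LG)(u)=c_\gamma\lim_{\epsilon\to0}\int_0^1\mathbf 1_{|u-v|\ge\epsilon}\frac{G(v)-G(u)}{|u-v|^{1+\gamma}}dv,\qquad u\in(0,1).$$ *)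

theory Defs
  imports "HOL-Analysis.Analysis"
begin

text \<open>
  \<open>G \<in> C\<^sup>\<infinity>([0,1])\<close>: derivatives of every order exist on the closed unit interval, one-sided
  at the endpoints.  The witness \<open>D n\<close> is the \<open>n\<close>-th derivative; only the values of \<open>G\<close>
  on \<open>[0,1]\<close> matter.
\<close>

definition smooth_unit_interval :: "(real \<Rightarrow> real) \<Rightarrow> bool" where
  "smooth_unit_interval G \<longleftrightarrow>
     (\<exists>D :: nat \<Rightarrow> real \<Rightarrow> real.
        (\<forall>u\<in>{0..1}. D 0 u = G u) \<and>
        (\<forall>n. \<forall>u\<in>{0..1}. (D n has_real_derivative D (Suc n) u) (at u within {0..1})))"

definition lattice :: "nat \<Rightarrow> int set" where
  "lattice N = {1..int N - 1}"

definition c_gamma :: "real \<Rightarrow> real" where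
  "c_gamma \<gamma> = inverse (\<Sum>\<^sub>\<infinity>z\<in>UNIV - {0::int}. (of_int \<bar>z\<bar> :: real) powr (- \<gamma> - 1))"

definition jump :: "real \<Rightarrow> int \<Rightarrow> real" where
  "jump \<gamma> z = (if z = 0 then 0 else c_gamma \<gamma> * of_int \<bar>z\<bar> powr (- \<gamma> - 1))"

text \<open>
  The last argument is the lattice site: \<open>discrete_gen \<gamma> N G x\<close> is the value of
  \<open>\<L>\<^sub>N G\<close> at the macroscopic point \<open>x / N\<close>.
\<close>

definition discrete_gen :: "real \<Rightarrow> nat \<Rightarrow> (real \<Rightarrow> real) \<Rightarrow> int \<Rightarrow> real" where
  "discrete_gen \<gamma> N G x =
     (\<Sum>y\<in>lattice N. jump \<gamma> (y - x) * (G (of_int y / real N) - G (of_int x / real N)))"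

definition truncated_integral :: "real \<Rightarrow> (real \<Rightarrow> real) \<Rightarrow> real \<Rightarrow> real \<Rightarrow> real" where
  "truncated_integral \<gamma> G u \<epsilon> =
     (LBINT v:{0..1}. indicator {v. \<epsilon> \<le> \<bar>u - v\<bar>} v * ((G v - G u) / \<bar>u - v\<bar> powr (1 + \<gamma>)))"

text \<open>Meaningful for \<open>u \<in> (0,1)\<close>; \<^const>\<open>Lim\<close> is unspecified where the limit does not exist.\<close>

definition regional_frac_laplacian :: "real \<Rightarrow> (real \<Rightarrow> real) \<Rightarrow> real \<Rightarrow> real" where
  "regional_frac_laplacian \<gamma> G u = c_gamma \<gamma> * Lim (at_right 0) (truncated_integral \<gamma> G u)"

end

theory Submission
  imports Defs
begin

text \<open>
  With \<open>h = 1/N\<close> and \<open>u = x h\<close>, the rescaled generator is \<open>c\<^sub>\<gamma>\<close> times a Riemann sum of mesh \<open>h\<close> for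
  the singular integral defining the regional fractional Laplacian at \<open>u\<close>.  On either side of \<open>u\<close> the
  increment is split as \<open>G(u \<plusminus> t) - G(u) = \<plusminus> G'(u) t + r(t)\<close>.

  The remainder gives \<open>f(t) = r(t) t\<^bsup>-1-\<gamma>\<^esup>\<close> with \<open>|f(t)| \<le> C t\<^bsup>1-\<gamma>\<^esup>\<close> and \<open>|f'(t)| \<le> C t\<^bsup>-\<gamma>\<^esup>\<close>, so its
  Riemann sum error is at most \<open>C h\<^bsup>2-\<gamma>\<^esup> \<Sum>\<^bsub>k\<le>N\<^esub> k\<^bsup>-\<gamma>\<^esup>\<close>, which tends to \<open>0\<close>.

  The linear parts of the two sides cancel up to the distance \<open>m h\<close> of \<open>u\<close> from the nearer endpoint,
  which leaves \<open>t\<^bsup>-\<gamma>\<^esup>\<close> on an interval starting at \<open>m h\<close>; by monotonicity its Riemann sum error telescopes to at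
  most \<open>h\<^bsup>1-\<gamma>\<^esup> m\<^bsup>-\<gamma>\<^esup>\<close>.  This is not uniformly small in \<open>x\<close> when \<open>\<gamma> \<ge> 1\<close>, but averaging it over \<open>x\<close>
  reproduces \<open>h\<^bsup>2-\<gamma>\<^esup> \<Sum>\<^bsub>k\<le>N\<^esub> k\<^bsup>-\<gamma>\<^esup>\<close>.
\<close>

section \<open>Decay of the error rate\<close>

definition riemann_err :: "real \<Rightarrow> nat \<Rightarrow> real" where
  "riemann_err \<gamma> N = real N powr (\<gamma> - 2) * (\<Sum>k=1..N. real k powr (- \<gamma>))"

text \<open>As \<open>k \<le> N\<close>, part of the negative power of \<open>N\<close> can be
  traded for the same power of \<open>k\<close>, leaving
  \<open>N powr (- d) * k powr (d - 2)\<close>. The series in \<open>k\<close> converges and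
  \<open>N powr (- d)\<close> vanishes, so no case distinction at \<open>\<gamma> = 1\<close>
  arises.\<close>

lemma riemann_err_tendsto_0:
  assumes "\<gamma> < 2"
  shows "riemann_err \<gamma> \<longlonglongrightarrow> 0"
proof -
  \<comment> \<open>\<open>d \<le> 2 - \<gamma>\<close> makes the traded exponent
    \<open>d + \<gamma> - 2\<close> nonpositive, and \<open>d \<le> 1/2\<close> puts
    \<open>d - 2\<close> below \<open>-1\<close>.\<close>
  define d where "d = min (2 - \<gamma>) (1/2)"
  have d: "0 < d" "d \<le> 2 - \<gamma>" "d - 2 < -1"
    using assms by (auto simp: d_def)
  define S where "S = (\<Sum>k. real k powr (d - 2))"
  have sm: "summable (\<lambda>k. real k powr (d - 2))"
    using d(3) by (simp add: summable_real_powr_iff)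
  have bd: "riemann_err \<gamma> N \<le> real N powr (- d) * S" for N
  proof -
    have *: "real N powr (\<gamma> - 2) * real k powr (- \<gamma>) \<le> real N powr (- d) * real k powr (d - 2)"
      if k: "k \<in> {1..N}" for k
    proof -
      have "real N powr (\<gamma> - 2) = real N powr (- d) * real N powr (d + \<gamma> - 2)"
        by (simp flip: powr_add)
      also have "\<dots> \<le> real N powr (- d) * real k powr (d + \<gamma> - 2)"
        using k d(2) by (intro mult_left_mono powr_mono2') auto
      finally have "real N powr (\<gamma> - 2) * real k powr (- \<gamma>)
          \<le> real N powr (- d) * real k powr (d + \<gamma> - 2) * real k powr (- \<gamma>)"
        by (rule mult_right_mono) simp
      then show ?thesis
        by (simp add: mult.assoc flip: powr_add)
    qed
    have "riemann_err \<gamma> N \<le> (\<Sum>k=1..N. real N powr (- d) * real k powr (d - 2))"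
      unfolding riemann_err_def sum_distrib_left by (intro sum_mono *)
    also have "\<dots> = real N powr (- d) * (\<Sum>k=1..N. real k powr (d - 2))"
      by (simp add: sum_distrib_left)
    also have "\<dots> \<le> real N powr (- d) * S"
      unfolding S_def by (intro mult_left_mono sum_le_suminf sm) auto
    finally show ?thesis .
  qed
  have "(\<lambda>N. real N powr (- d) * S) \<longlonglongrightarrow> 0"
    using d(1) by (intro tendsto_mult_left_zero tendsto_neg_powr filterlim_real_sequentially) auto
  moreover have "0 \<le> riemann_err \<gamma> N" for N
    unfolding riemann_err_def by (intro mult_nonneg_nonneg sum_nonneg) auto
  ultimately show ?thesis
    using bd by (intro tendsto_sandwich[where f = "\<lambda>_. 0" and g = "riemann_err \<gamma>" and h = "\<lambda>N. real N powr (- d) * S"] tendsto_const always_eventually allI)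
qed

section \<open>Left Riemann sums\<close>

text \<open>Induction on the right end, one cell at a time. \<open>e k\<close> bounds the
  oscillation from the left node of a cell; leaving it free allows a Lipschitz bound as well as a
  monotonicity bound that telescopes.\<close>

lemma left_riemann_sum_error:
  fixes f :: "real \<Rightarrow> real"
  assumes "0 \<le> h" "m \<le> n"
    and "f integrable_on {real m * h..real n * h}"
    and "\<And>k t. k \<in> {m..<n} \<Longrightarrow> t \<in> {real k * h..real (Suc k) * h} \<Longrightarrow> \<bar>f (real k * h) - f t\<bar> \<le> e k"
  shows "\<bar>h * (\<Sum>k=m..<n. f (real k * h)) - integral {real m * h..real n * h} f\<bar> \<le> h * (\<Sum>k=m..<n. e k)"
  using assms(2-4)
proof (induction n rule: dec_induct)
  case base
  then show ?case by simp
next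
  case (step n)
  have le: "real m * h \<le> real n * h" "real n * h \<le> real (Suc n) * h"
    using step(1) assms(1) by (auto intro!: mult_right_mono)
  have int1: "f integrable_on {real m * h..real n * h}"
    and int2: "f integrable_on {real n * h..real (Suc n) * h}"
    using le by (auto intro: integrable_subinterval_real[OF step.prems(1)])
  have IH: "\<bar>h * (\<Sum>k=m..<n. f (real k * h)) - integral {real m * h..real n * h} f\<bar> \<le> h * (\<Sum>k=m..<n. e k)"
    using step.prems(2) by (intro step.IH int1) auto
  have len: "real (Suc n) * h - real n * h = h"
    by (simp add: algebra_simps)
  have const: "((\<lambda>t. f (real n * h)) has_integral h * f (real n * h)) {real n * h..real (Suc n) * h}"
    using has_integral_const_real[of "f (real n * h)" "real n * h" "real (Suc n) * h"] le len by simp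
  have diff: "((\<lambda>t. f (real n * h) - f t) has_integral
      (h * f (real n * h) - integral {real n * h..real (Suc n) * h} f)) {real n * h..real (Suc n) * h}"
    by (intro has_integral_diff const integrable_integral int2)
  \<comment> \<open>The oscillation bound at the node itself, \<open>t = real n * h\<close>, has
    left side \<open>0\<close>.\<close>
  have "0 \<le> e n"
    using step.prems(2)[of n "real n * h"] step(1) le by force
  then have "norm (h * f (real n * h) - integral {real n * h..real (Suc n) * h} f)
      \<le> e n * measure lborel {real n * h..real (Suc n) * h}"
    using step.prems(2)[of n] step(1)
    by (intro has_integral_bound_real[OF _ _ diff, of _ "{}"]) auto
  then have new: "\<bar>h * f (real n * h) - integral {real n * h..real (Suc n) * h} f\<bar> \<le> h * e n"
    using le len by (simp add: mult.commute)
  have "integral {real m * h..real (Suc n) * h} f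
      = integral {real m * h..real n * h} f + integral {real n * h..real (Suc n) * h} f"
    by (rule Henstock_Kurzweil_Integration.integral_combine[OF le step.prems(1), symmetric])
  with IH new step(1) show ?case
    by (simp add: distrib_left)
qed

section \<open>The Taylor remainder against the singular kernel\<close>

text \<open>The remainder is O(t^2) and its derivative O(t), so the kernel leaves the exponents
  \<open>1 - \<gamma>\<close> for \<open>f\<close> and \<open>- \<gamma>\<close> for its derivative.
  The first exceeds \<open>-1\<close>, hence \<open>f\<close> is integrable up to \<open>0\<close>;
  the second blows up at \<open>0\<close>, hence the Lipschitz bound depends on the distance
  \<open>r\<close> from \<open>0\<close>.\<close>

lemma taylor_remainder_powr:
  fixes g g' g'' :: "real \<Rightarrow> real"
  assumes \<gamma>: "0 < \<gamma>" "\<gamma> < 2" and "0 \<le> M"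
    and g: "\<And>t. t \<in> {0..b} \<Longrightarrow> (g has_real_derivative g' t) (at t within {0..b})"
    and g': "\<And>t. t \<in> {0..b} \<Longrightarrow> (g' has_real_derivative g'' t) (at t within {0..b})"
    and M: "\<And>t. t \<in> {0..b} \<Longrightarrow> \<bar>g'' t\<bar> \<le> M"
  defines "f \<equiv> \<lambda>t. (g t - g 0 - g' 0 * t) * t powr (- 1 - \<gamma>)"
  shows taylor_remainder_powr_bound: "\<And>t. t \<in> {0..b} \<Longrightarrow> \<bar>f t\<bar> \<le> M * t powr (1 - \<gamma>)"
    and taylor_remainder_powr_lipschitz:
      "\<And>r s t. \<lbrakk>0 < r; r \<le> s; s \<le> b; r \<le> t; t \<le> b\<rbrakk> \<Longrightarrow> \<bar>f s - f t\<bar> \<le> 4 * M * r powr (- \<gamma>) * \<bar>s - t\<bar>"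
    and taylor_remainder_powr_integrable: "f integrable_on {0..b}"
proof -
  have g'_bound: "\<bar>g' t - g' 0\<bar> \<le> M * t" if "t \<in> {0..b}" for t
    using field_differentiable_bound[OF convex_real_interval(5) g', of M t 0] M that by auto
  \<comment> \<open>Mean value inequality for \<open>g s - g' 0 * s\<close> on
    \<open>{0..t}\<close>, where the derivative is at most \<open>M * t\<close> in absolute
    value.\<close>
  have g_bound: "\<bar>g t - g 0 - g' 0 * t\<bar> \<le> M * t * t" if t: "t \<in> {0..b}" for t
  proof -
    have "((\<lambda>s. g s - g' 0 * s) has_real_derivative g' s - g' 0) (at s within {0..t})"
      if "s \<in> {0..t}" for s
      by (rule DERIV_subset[where s = "{0..b}"]) (use that t in \<open>auto intro!: derivative_eq_intros g\<close>)
    moreover have "norm (g' s - g' 0) \<le> M * t" if "s \<in> {0..t}" for s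
      using g'_bound[of s] that t \<open>0 \<le> M\<close> mult_left_mono[of s t M] by auto
    ultimately have "norm ((g t - g' 0 * t) - (g 0 - g' 0 * 0)) \<le> M * t * norm (t - 0)"
      using t by (intro field_differentiable_bound[OF convex_real_interval(5)[of 0 t], of _ "\<lambda>s. g' s - g' 0"]) auto
    then show ?thesis
      using t by (simp add: algebra_simps)
  qed
  show bound: "\<bar>f t\<bar> \<le> M * t powr (1 - \<gamma>)" if t: "t \<in> {0..b}" for t
  proof -
    have "\<bar>f t\<bar> \<le> M * t * t * t powr (- 1 - \<gamma>)"
      unfolding f_def abs_mult using g_bound[OF t] by (intro mult_mono) auto
    also have "\<dots> = M * (t powr 2 * t powr (- 1 - \<gamma>))"
      using t by (simp add: power2_eq_square)
    also have "\<dots> = M * t powr (1 - \<gamma>)"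
      by (simp flip: powr_add)
    finally show ?thesis .
  qed
  define f' where "f' t = (g' t - g' 0) * t powr (- 1 - \<gamma>)
    + (g t - g 0 - g' 0 * t) * ((- 1 - \<gamma>) * t powr (- 2 - \<gamma>))" for t
  have f_deriv: "(f has_real_derivative f' t) (at t within {0..b})" if "0 < t" "t \<le> b" for t
  proof -
    have "((\<lambda>t. t powr (- 1 - \<gamma>)) has_real_derivative (- 1 - \<gamma>) * t powr (- 1 - \<gamma> - 1)) (at t within {0..b})"
      by (rule has_field_derivative_at_within[OF has_real_derivative_powr[OF that(1)]])
    moreover have "- 1 - \<gamma> - 1 = - 2 - \<gamma>" by simp
    ultimately show ?thesis
      unfolding f_def f'_def using that by (auto intro!: derivative_eq_intros g)
  qed
  have f'_bound: "\<bar>f' t\<bar> \<le> 4 * M * r powr (- \<gamma>)" if t: "0 < r" "r \<le> t" "t \<le> b" for r t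
  proof -
    have "\<bar>f' t\<bar> \<le> \<bar>g' t - g' 0\<bar> * t powr (- 1 - \<gamma>)
        + \<bar>g t - g 0 - g' 0 * t\<bar> * ((1 + \<gamma>) * t powr (- 2 - \<gamma>))"
      unfolding f'_def using \<gamma> by (intro order_trans[OF abs_triangle_ineq]) (simp add: abs_mult add.commute)
    also have "\<dots> \<le> M * t * t powr (- 1 - \<gamma>) + M * t * t * ((1 + \<gamma>) * t powr (- 2 - \<gamma>))"
      using g_bound[of t] g'_bound[of t] t \<gamma> by (intro add_mono mult_right_mono) auto
    also have "\<dots> = M * (t powr 1 * t powr (- 1 - \<gamma>)) + M * (1 + \<gamma>) * (t powr 2 * t powr (- 2 - \<gamma>))"
      using t by (simp add: power2_eq_square)
    also have "\<dots> = (2 + \<gamma>) * (M * t powr (- \<gamma>))"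
      by (simp only: powr_add[symmetric]) (simp add: algebra_simps)
    \<comment> \<open>\<open>2 + \<gamma> < 4\<close> gives the constant, and the negative power is
      largest at the left end \<open>r\<close>.\<close>
    also have "\<dots> \<le> 4 * (M * r powr (- \<gamma>))"
      using t \<gamma> \<open>0 \<le> M\<close> by (intro mult_mono mult_left_mono powr_mono2') auto
    finally show ?thesis by simp
  qed
  show "\<bar>f s - f t\<bar> \<le> 4 * M * r powr (- \<gamma>) * \<bar>s - t\<bar>"
    if "0 < r" "r \<le> s" "s \<le> b" "r \<le> t" "t \<le> b" for r s t
    using field_differentiable_bound[OF convex_real_interval(5)[of r b], of f f' "4 * M * r powr (- \<gamma>)" s t]
      f'_bound[of r] DERIV_subset[OF f_deriv, of _ "{r..b}"] that by auto
  show "f integrable_on {0..b}"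
  proof (cases "0 \<le> b")
    case True
    show ?thesis
    proof (rule measurable_bounded_by_integrable_imp_integrable)
      \<comment> \<open>Differentiability gives continuity only away from \<open>0\<close>.
        Measurability on the closed interval follows because \<open>f 0 = 0\<close>, so the
        extensions by zero from \<open>{0<..b}\<close> and from \<open>{0..b}\<close>
        coincide.\<close>
      have "continuous_on {0<..b} f"
        unfolding continuous_on_eq_continuous_within
        using DERIV_subset[OF f_deriv, of _ "{0<..b}"]
        by (auto intro!: DERIV_continuous simp: subset_eq)
      then have "f \<in> borel_measurable (lebesgue_on {0<..b})"
        by (intro continuous_imp_measurable_on_sets_lebesgue) auto
      then have "(\<lambda>t. if t \<in> {0<..b} then f t else 0) \<in> borel_measurable lebesgue"
        by (subst borel_measurable_if) auto
      moreover have "(\<lambda>t. if t \<in> {0<..b} then f t else 0) = (\<lambda>t. if t \<in> {0..b} then f t else 0)"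
        by (auto simp: f_def)
      ultimately show "f \<in> borel_measurable (lebesgue_on {0..b})"
        by (intro borel_measurable_if_D) (simp only:)
      show "(\<lambda>t. M * t powr (1 - \<gamma>)) integrable_on {0..b}"
        using \<gamma> True by (intro integrable_on_mult_right integrable_on_powr_from_0) auto
    qed (use bound in auto)
  qed auto
qed

text \<open>The sum starts at \<open>k = 1\<close>, so the integral over the cell
  \<open>{0..h}\<close> is bounded outright through \<open>M * t powr (1 - \<gamma>)\<close>, which
  gives \<open>1 / (2 - \<gamma>)\<close>. Every other cell uses the Lipschitz bound with
  \<open>r = real k * h\<close>, which gives the \<open>4\<close>. Summing up to \<open>N\<close>
  instead of \<open>n\<close> makes the bound the same for all lattice sites.\<close>

lemma taylor_remainder_riemann_sum_error:
  fixes g g' g'' :: "real \<Rightarrow> real"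
  assumes \<gamma>: "0 < \<gamma>" "\<gamma> < 2" and M0: "0 \<le> M" and h: "0 < h" and n: "1 \<le> n" "n \<le> N"
    and g: "\<And>t. t \<in> {0..real n * h} \<Longrightarrow> (g has_real_derivative g' t) (at t within {0..real n * h})"
    and g': "\<And>t. t \<in> {0..real n * h} \<Longrightarrow> (g' has_real_derivative g'' t) (at t within {0..real n * h})"
    and M: "\<And>t. t \<in> {0..real n * h} \<Longrightarrow> \<bar>g'' t\<bar> \<le> M"
  defines "f \<equiv> \<lambda>t. (g t - g 0 - g' 0 * t) * t powr (- 1 - \<gamma>)"
  shows "\<bar>h * (\<Sum>k=1..<n. f (real k * h)) - integral {0..real n * h} f\<bar>
    \<le> M * (4 + 1 / (2 - \<gamma>)) * (h powr (2 - \<gamma>) * (\<Sum>k=1..N. real k powr (- \<gamma>)))"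
proof -
  define S where "S = (\<Sum>k=1..N. real k powr (- \<gamma>))"
  have hn: "h \<le> real n * h"
    using n(1) h by simp
  have int: "f integrable_on {0..real n * h}"
    unfolding f_def by (rule taylor_remainder_powr_integrable[OF \<gamma> M0 g g' M])
  have lip: "\<bar>f s - f t\<bar> \<le> 4 * M * r powr (- \<gamma>) * \<bar>s - t\<bar>"
    if "0 < r" "r \<le> s" "s \<le> real n * h" "r \<le> t" "t \<le> real n * h" for r s t
    unfolding f_def by (rule taylor_remainder_powr_lipschitz[OF \<gamma> M0 g g' M that])
  have bound: "\<bar>f t\<bar> \<le> M * t powr (1 - \<gamma>)" if "t \<in> {0..real n * h}" for t
    unfolding f_def by (rule taylor_remainder_powr_bound[OF \<gamma> M0 g g' M that])
  define e where "e k = 4 * M * (real k * h) powr (- \<gamma>) * h" for k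
  have "\<bar>h * (\<Sum>k=1..<n. f (real k * h)) - integral {real 1 * h..real n * h} f\<bar> \<le> h * (\<Sum>k=1..<n. e k)"
  proof (rule left_riemann_sum_error)
    show "f integrable_on {real 1 * h..real n * h}"
      using h by (intro integrable_subinterval_real[OF int]) auto
    fix k t assume k: "k \<in> {1..<n}" and t: "t \<in> {real k * h..real (Suc k) * h}"
    have kn: "real (Suc k) * h \<le> real n * h"
      using k h by (intro mult_right_mono) auto
    have tn: "t \<le> real n * h"
      using t kn by (meson atLeastAtMost_iff order_trans)
    have "\<bar>f (real k * h) - f t\<bar> \<le> 4 * M * (real k * h) powr (- \<gamma>) * \<bar>real k * h - t\<bar>"
      using k t h tn by (intro lip) auto
    also have "\<dots> \<le> e k"
      unfolding e_def using t M0 by (intro mult_left_mono) (auto simp: algebra_simps)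
    finally show "\<bar>f (real k * h) - f t\<bar> \<le> e k" .
  qed (use n h in auto)
  also have "h * (\<Sum>k=1..<n. e k) = 4 * M * (h powr 1 * h powr 1 * h powr (- \<gamma>)) * (\<Sum>k=1..<n. real k powr (- \<gamma>))"
    using h by (simp add: e_def powr_mult sum_distrib_left mult_ac)
  also have "h powr 1 * h powr 1 * h powr (- \<gamma>) = h powr (2 - \<gamma>)"
    by (simp only: powr_add[symmetric]) simp
  also have "4 * M * h powr (2 - \<gamma>) * (\<Sum>k=1..<n. real k powr (- \<gamma>)) \<le> 4 * M * h powr (2 - \<gamma>) * S"
    unfolding S_def using M0 n by (intro mult_left_mono sum_mono2) auto
  finally have main: "\<bar>h * (\<Sum>k=1..<n. f (real k * h)) - integral {h..real n * h} f\<bar>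
      \<le> 4 * M * h powr (2 - \<gamma>) * S" by simp
  have I: "((\<lambda>t. M * t powr (1 - \<gamma>)) has_integral M * (h powr (2 - \<gamma>) / (2 - \<gamma>))) {0..h}"
    using has_integral_powr_from_0[of "1 - \<gamma>" h] \<gamma> h by (intro has_integral_mult_right) auto
  have sub: "{0..h} \<subseteq> {0..real n * h}"
    using hn by (simp only: atLeastatMost_subset_iff) simp
  have "norm (integral {0..h} f) \<le> integral {0..h} (\<lambda>t. M * t powr (1 - \<gamma>))"
  proof (rule Henstock_Kurzweil_Integration.integral_norm_bound_integral)
    show "f integrable_on {0..h}"
      by (rule integrable_subinterval_real[OF int sub])
    show "(\<lambda>t. M * t powr (1 - \<gamma>)) integrable_on {0..h}"
      using I by (rule has_integral_integrable)
    show "norm (f t) \<le> M * t powr (1 - \<gamma>)" if "t \<in> {0..h}" for t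
      using bound[OF subsetD[OF sub that]] by simp
  qed
  \<comment> \<open>The factor \<open>1\<close> is a placeholder for \<open>S\<close>, whose first
    term is already \<open>1\<close>.\<close>
  then have "\<bar>integral {0..h} f\<bar> \<le> M * (1 / (2 - \<gamma>)) * h powr (2 - \<gamma>) * 1"
    using integral_unique[OF I] by simp
  also have "\<dots> \<le> M * (1 / (2 - \<gamma>)) * h powr (2 - \<gamma>) * S"
  proof (rule mult_left_mono)
    show "1 \<le> S"
      unfolding S_def using n member_le_sum[of 1 "{1..N}" "\<lambda>k. real k powr (- \<gamma>)"] by simp
  qed (use \<gamma> M0 in auto)
  finally have "\<bar>integral {0..h} f\<bar> \<le> M * (1 / (2 - \<gamma>)) * h powr (2 - \<gamma>) * S" .
  moreover have "integral {0..real n * h} f = integral {0..h} f + integral {h..real n * h} f"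
    using Henstock_Kurzweil_Integration.integral_combine[OF _ hn int] h by simp
  ultimately show ?thesis
    using main unfolding S_def[symmetric] by (simp add: algebra_simps)
qed

section \<open>Riemann sums of the linear part\<close>

lemma powr_integrable_on_pos: "0 < a \<Longrightarrow> (\<lambda>t. t powr p) integrable_on {a..b :: real}"
  by (intro integrable_continuous_real continuous_intros) auto

text \<open>For a decreasing function the oscillation on a cell is at most the drop between its
  ends, and the drops telescope to at most the first value.\<close>

lemma powr_riemann_sum_error:
  assumes \<gamma>: "0 < \<gamma>" and h: "0 < h" and m: "1 \<le> m" "m \<le> n"
  shows "\<bar>h * (\<Sum>k=m..<n. (real k * h) powr (- \<gamma>)) - integral {real m * h..real n * h} (\<lambda>t. t powr (- \<gamma>))\<bar>
    \<le> h powr (1 - \<gamma>) * real m powr (- \<gamma>)"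
proof -
  have "\<bar>h * (\<Sum>k=m..<n. (real k * h) powr (- \<gamma>)) - integral {real m * h..real n * h} (\<lambda>t. t powr (- \<gamma>))\<bar>
    \<le> h * (\<Sum>k=m..<n. (real k * h) powr (- \<gamma>) - (real (Suc k) * h) powr (- \<gamma>))"
  proof (rule left_riemann_sum_error)
    fix k t assume k: "k \<in> {m..<n}" and t: "t \<in> {real k * h..real (Suc k) * h}"
    have "0 < real k * h"
      using k m h by simp
    then have "t powr (- \<gamma>) \<le> (real k * h) powr (- \<gamma>)" "(real (Suc k) * h) powr (- \<gamma>) \<le> t powr (- \<gamma>)"
      using t \<gamma> by (auto intro!: powr_mono2')
    then show "\<bar>(real k * h) powr (- \<gamma>) - t powr (- \<gamma>)\<bar> \<le> (real k * h) powr (- \<gamma>) - (real (Suc k) * h) powr (- \<gamma>)"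
      by simp
  qed (use m h in \<open>auto intro: powr_integrable_on_pos\<close>)
  also have "(\<Sum>k=m..<n. (real k * h) powr (- \<gamma>) - (real (Suc k) * h) powr (- \<gamma>))
      = (real m * h) powr (- \<gamma>) - (real n * h) powr (- \<gamma>)"
    using sum_Suc_diff'[OF m(2), of "\<lambda>k. - ((real k * h) powr (- \<gamma>))"] by simp
  also have "h * \<dots> \<le> h * (real m * h) powr (- \<gamma>)"
    using h by (intro mult_left_mono) auto
  also have "\<dots> = (h powr 1 * h powr (- \<gamma>)) * real m powr (- \<gamma>)"
    using h by (simp add: powr_mult)
  also have "h powr 1 * h powr (- \<gamma>) = h powr (1 - \<gamma>)"
    by (simp only: powr_add[symmetric]) simp
  finally show ?thesis .
qed

text \<open>\<open>m\<close> and \<open>n\<close> count the steps from a site to the two endpoints.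
  Up to the smaller of them the sums cancel, and so do the integrals, whatever the cutoff
  \<open>\<epsilon>\<close>; only the range between \<open>m\<close> and \<open>n\<close>
  contributes. The bound carries both powers to be symmetric, so that \<open>m \<le> n\<close> may
  be assumed.\<close>

lemma powr_riemann_sum_difference_error:
  assumes \<gamma>: "0 < \<gamma>" and h: "0 < h" and mn: "1 \<le> m" "1 \<le> n"
    and \<epsilon>: "0 < \<epsilon>" "\<epsilon> \<le> real m * h" "\<epsilon> \<le> real n * h"
  shows "\<bar>h * (\<Sum>k=1..<n. (real k * h) powr (- \<gamma>)) - h * (\<Sum>k=1..<m. (real k * h) powr (- \<gamma>))
      - (integral {\<epsilon>..real n * h} (\<lambda>t. t powr (- \<gamma>)) - integral {\<epsilon>..real m * h} (\<lambda>t. t powr (- \<gamma>)))\<bar>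
    \<le> h powr (1 - \<gamma>) * (real m powr (- \<gamma>) + real n powr (- \<gamma>))"
  using mn \<epsilon>
proof (induction m n rule: linorder_wlog)
  case (le m n)
  have "(\<Sum>k=1..<n. (real k * h) powr (- \<gamma>))
      = (\<Sum>k=1..<m. (real k * h) powr (- \<gamma>)) + (\<Sum>k=m..<n. (real k * h) powr (- \<gamma>))"
    using le by (simp add: sum.atLeastLessThan_concat)
  moreover have "integral {\<epsilon>..real n * h} (\<lambda>t. t powr (- \<gamma>))
      = integral {\<epsilon>..real m * h} (\<lambda>t. t powr (- \<gamma>)) + integral {real m * h..real n * h} (\<lambda>t. t powr (- \<gamma>))"
    using le h
    by (intro Henstock_Kurzweil_Integration.integral_combine[symmetric] powr_integrable_on_pos) auto
  moreover have "\<bar>h * (\<Sum>k=m..<n. (real k * h) powr (- \<gamma>)) - integral {real m * h..real n * h} (\<lambda>t. t powr (- \<gamma>))\<bar>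
      \<le> h powr (1 - \<gamma>) * real m powr (- \<gamma>)"
    using le by (intro powr_riemann_sum_error \<gamma> h)
  moreover have "0 \<le> h powr (1 - \<gamma>) * real n powr (- \<gamma>)"
    by simp
  ultimately show ?case
    by (simp only: distrib_left)
next
  case (sym m n)
  then show ?case
    by (simp add: add.commute abs_minus_commute)
qed

section \<open>Both operators in terms of the distance from the site\<close>

text \<open>For such \<open>\<epsilon>\<close> the truncated domain consists of two intervals that
  avoid \<open>u\<close>. The integrand is continuous on them, so Lebesgue and gauge integrals
  agree, and a shift or reflection turns \<open>v\<close> into the distance \<open>t\<close> from
  \<open>u\<close>.\<close>

lemma truncated_integral_eq:
  assumes cont: "continuous_on {0..1} G" and \<epsilon>: "0 < \<epsilon>" "\<epsilon> \<le> u" "\<epsilon> \<le> 1 - u"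
  shows "truncated_integral \<gamma> G u \<epsilon>
    = integral {\<epsilon>..1 - u} (\<lambda>t. (G (u + t) - G u) * t powr (- 1 - \<gamma>))
      + integral {\<epsilon>..u} (\<lambda>t. (G (u - t) - G u) * t powr (- 1 - \<gamma>))"
proof -
  define F where "F v = (G v - G u) / \<bar>u - v\<bar> powr (1 + \<gamma>)" for v
  have contF: "continuous_on {a..b} F" if "0 \<le> a" "b \<le> 1" "u \<notin> {a..b}" for a b
    unfolding F_def
    by (intro continuous_intros continuous_on_subset[OF cont]) (use that in auto)
  have "truncated_integral \<gamma> G u \<epsilon> = (LBINT v:{0..u - \<epsilon>} \<union> {u + \<epsilon>..1}. F v)"
    unfolding truncated_integral_def set_lebesgue_integral_def F_def using \<epsilon>
    by (intro Bochner_Integration.integral_cong refl) (auto simp: indicator_def)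
  also have "\<dots> = (LBINT v:{0..u - \<epsilon>}. F v) + (LBINT v:{u + \<epsilon>..1}. F v)"
    using \<epsilon> by (intro set_integral_Un borel_integrable_atLeastAtMost' contF) auto
  also have "\<dots> = integral {0..u - \<epsilon>} F + integral {u + \<epsilon>..1} F"
    using \<epsilon> by (intro arg_cong2[where f = "(+)"] set_borel_integral_eq_integral borel_integrable_atLeastAtMost' contF) auto
  also have "integral {0..u - \<epsilon>} F = integral {\<epsilon>..u} (\<lambda>t. F (u - t))"
  proof -
    have "integral {0..u - \<epsilon>} F = integral {- u..- \<epsilon>} (\<lambda>t. F (t + u))"
      using integral_shift_real_ivl[of 0 u "u - \<epsilon>" F] by simp
    also have "\<dots> = integral {\<epsilon>..u} (\<lambda>t. F (- t + u))"
      using Henstock_Kurzweil_Integration.integral_reflect_real[of u \<epsilon> "\<lambda>t. F (- t + u)"] by simp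
    finally show ?thesis by simp
  qed
  also have "\<dots> = integral {\<epsilon>..u} (\<lambda>t. (G (u - t) - G u) * t powr (- 1 - \<gamma>))"
    using \<epsilon> by (intro Henstock_Kurzweil_Integration.integral_cong)
      (auto simp: F_def divide_inverse simp flip: powr_minus)
  also have "integral {u + \<epsilon>..1} F = integral {\<epsilon>..1 - u} (\<lambda>t. F (t + u))"
    using integral_shift_real_ivl[of "u + \<epsilon>" u 1 F] by simp
  also have "\<dots> = integral {\<epsilon>..1 - u} (\<lambda>t. (G (u + t) - G u) * t powr (- 1 - \<gamma>))"
    using \<epsilon> by (intro Henstock_Kurzweil_Integration.integral_cong)
      (auto simp: F_def divide_inverse add.commute simp flip: powr_minus)
  finally show ?thesis by simp
qed

text \<open>Since \<open>real N powr \<gamma> = h * h powr (- 1 - \<gamma>)\<close>, the rescaled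
  jump rate is \<open>c_gamma \<gamma>\<close> times the mesh times the kernel at distance
  \<open>k * h\<close>. The lattice omits \<open>0\<close> and \<open>N\<close>, so \<open>k\<close>
  stops before \<open>N - x\<close> and before \<open>x\<close>: these are exactly the left nodes of
  the cells filling \<open>{h..1 - u}\<close> and \<open>{h..u}\<close>.\<close>

lemma discrete_gen_eq:
  assumes x: "1 \<le> x" "x < N"
  defines "h \<equiv> 1 / real N" and "u \<equiv> real x / real N"
  shows "real N powr \<gamma> * discrete_gen \<gamma> N G (int x)
    = c_gamma \<gamma> *
      (h * (\<Sum>k=1..<N - x. (G (u + real k * h) - G u) * (real k * h) powr (- 1 - \<gamma>))
       + h * (\<Sum>k=1..<x. (G (u - real k * h) - G u) * (real k * h) powr (- 1 - \<gamma>)))"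
proof -
  define F where "F y = jump \<gamma> (y - int x) * (G (of_int y / real N) - G (of_int (int x) / real N))" for y
  have N: "0 < real N"
    using x by simp
  have scale: "real N powr \<gamma> * jump \<gamma> z = c_gamma \<gamma> * (h * (real k * h) powr (- 1 - \<gamma>))"
    if "\<bar>z\<bar> = int k" "1 \<le> k" for z k
  proof -
    have "of_int \<bar>z\<bar> = real k"
      using that by simp
    then have "jump \<gamma> z = c_gamma \<gamma> * real k powr (- 1 - \<gamma>)"
      using that by (auto simp: jump_def simp del: of_int_abs intro!: arg_cong[where f = "\<lambda>p. _ powr p"])
    moreover have "real N powr \<gamma> = h * h powr (- 1 - \<gamma>)"
    proof -
      have "h * h powr (- 1 - \<gamma>) = h powr 1 * h powr (- 1 - \<gamma>)"
        using N by (simp add: h_def)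
      also have "\<dots> = h powr (- \<gamma>)"
        by (simp only: powr_add[symmetric]) simp
      also have "\<dots> = real N powr \<gamma>"
        using N by (simp add: h_def powr_divide powr_minus field_simps)
      finally show ?thesis by simp
    qed
    ultimately show ?thesis
      by (simp only: powr_mult mult_ac)
  qed
  \<comment> \<open>The site itself, where the increment vanishes, then the sites to its right and
    to its left, indexed by distance.\<close>
  have split: "lattice N = insert (int x) ((\<lambda>k. int x + int k) ` {1..<N - x} \<union> (\<lambda>k. int x - int k) ` {1..<x})"
  proof (intro equalityI subsetI)
    fix y assume y: "y \<in> lattice N"
    consider "y = int x" | "y > int x" | "y < int x" by linarith
    then show "y \<in> insert (int x) ((\<lambda>k. int x + int k) ` {1..<N - x} \<union> (\<lambda>k. int x - int k) ` {1..<x})"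
    proof cases
      case 2
      then have "y = int x + int (nat (y - int x))" "nat (y - int x) \<in> {1..<N - x}"
        using y x by (auto simp: lattice_def)
      then show ?thesis by blast
    next
      case 3
      then have "y = int x - int (nat (int x - y))" "nat (int x - y) \<in> {1..<x}"
        using y x by (auto simp: lattice_def)
      then show ?thesis by blast
    qed simp
  qed (use x in \<open>auto simp: lattice_def\<close>)
  have "discrete_gen \<gamma> N G (int x) = (\<Sum>y\<in>lattice N. F y)"
    by (simp add: discrete_gen_def F_def)
  also have "\<dots> = F (int x) + (\<Sum>y\<in>(\<lambda>k. int x + int k) ` {1..<N - x} \<union> (\<lambda>k. int x - int k) ` {1..<x}. F y)"
    unfolding split by (rule sum.insert) auto
  also have "F (int x) = 0"
    by (simp add: F_def)
  also have "(\<Sum>y\<in>(\<lambda>k. int x + int k) ` {1..<N - x} \<union> (\<lambda>k. int x - int k) ` {1..<x}. F y)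
      = (\<Sum>y\<in>(\<lambda>k. int x + int k) ` {1..<N - x}. F y) + (\<Sum>y\<in>(\<lambda>k. int x - int k) ` {1..<x}. F y)"
    by (intro sum.union_disjoint) auto
  also have "\<dots> = (\<Sum>k=1..<N - x. F (int x + int k)) + (\<Sum>k=1..<x. F (int x - int k))"
    by (subst (1 2) sum.reindex) (auto simp: inj_on_def)
  finally have "real N powr \<gamma> * discrete_gen \<gamma> N G (int x)
      = (\<Sum>k=1..<N - x. real N powr \<gamma> * F (int x + int k)) + (\<Sum>k=1..<x. real N powr \<gamma> * F (int x - int k))"
    by (simp add: sum_distrib_left distrib_left)
  also have "(\<Sum>k=1..<N - x. real N powr \<gamma> * F (int x + int k))
      = (\<Sum>k=1..<N - x. c_gamma \<gamma> * (h * ((G (u + real k * h) - G u) * (real k * h) powr (- 1 - \<gamma>))))"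
  proof (rule sum.cong)
    fix k assume "k \<in> {1..<N - x}"
    then have "real N powr \<gamma> * F (int x + int k)
        = c_gamma \<gamma> * (h * (real k * h) powr (- 1 - \<gamma>)) * (G (u + real k * h) - G u)"
      unfolding F_def mult.assoc[symmetric] using N
      by (subst scale[of _ k]) (auto simp: u_def h_def add_divide_distrib)
    then show "real N powr \<gamma> * F (int x + int k)
        = c_gamma \<gamma> * (h * ((G (u + real k * h) - G u) * (real k * h) powr (- 1 - \<gamma>)))"
      by (simp add: mult_ac)
  qed simp
  also have "(\<Sum>k=1..<x. real N powr \<gamma> * F (int x - int k))
      = (\<Sum>k=1..<x. c_gamma \<gamma> * (h * ((G (u - real k * h) - G u) * (real k * h) powr (- 1 - \<gamma>))))"
  proof (rule sum.cong)
    fix k assume "k \<in> {1..<x}"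
    then have "real N powr \<gamma> * F (int x - int k)
        = c_gamma \<gamma> * (h * (real k * h) powr (- 1 - \<gamma>)) * (G (u - real k * h) - G u)"
      unfolding F_def mult.assoc[symmetric] using N
      by (subst scale[of _ k]) (auto simp: u_def h_def diff_divide_distrib)
    then show "real N powr \<gamma> * F (int x - int k)
        = c_gamma \<gamma> * (h * ((G (u - real k * h) - G u) * (real k * h) powr (- 1 - \<gamma>)))"
      by (simp add: mult_ac)
  qed simp
  finally show ?thesis
    by (simp add: sum_distrib_left distrib_left)
qed

section \<open>Error at a single lattice site\<close>

lemma has_real_derivative_affine_within:
  fixes G :: "real \<Rightarrow> real"
  assumes "(G has_real_derivative D) (at (u + c * t) within T)"
    and "(\<lambda>s. u + c * s) ` S \<subseteq> T"
  shows "((\<lambda>s. G (u + c * s)) has_real_derivative D * c) (at t within S)"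
proof -
  have "((\<lambda>s. u + c * s) has_real_derivative c) (at t within S)"
    by (auto intro!: derivative_eq_intros)
  from DERIV_image_chain[OF DERIV_subset[OF assms] this] show ?thesis
    by (simp add: o_def)
qed

text \<open>The first term collects the Taylor remainder errors of both sides, the second the
  uncancelled linear part, which is large near the endpoints when \<open>\<gamma> > 1\<close>. The
  proof also establishes that the principal value exists.\<close>

lemma discretization_error:
  fixes G G1 G2 :: "real \<Rightarrow> real"
  assumes \<gamma>: "0 < \<gamma>" "\<gamma> < 2"
    and G: "\<And>v. v \<in> {0..1} \<Longrightarrow> (G has_real_derivative G1 v) (at v within {0..1})"
    and G1: "\<And>v. v \<in> {0..1} \<Longrightarrow> (G1 has_real_derivative G2 v) (at v within {0..1})"
    and M1: "\<And>v. v \<in> {0..1} \<Longrightarrow> \<bar>G1 v\<bar> \<le> M1"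
    and M2: "\<And>v. v \<in> {0..1} \<Longrightarrow> \<bar>G2 v\<bar> \<le> M2"
    and x: "1 \<le> x" "x < N"
  shows "\<bar>real N powr \<gamma> * discrete_gen \<gamma> N G (int x) - regional_frac_laplacian \<gamma> G (real x / real N)\<bar>
    \<le> \<bar>c_gamma \<gamma>\<bar> * (2 * M2 * (4 + 1 / (2 - \<gamma>)) * riemann_err \<gamma> N
        + M1 * (real N powr (\<gamma> - 1) * (real x powr (- \<gamma>) + real (N - x) powr (- \<gamma>))))"
proof -
  define h where "h = 1 / real N"
  define u where "u = real x / real N"
  define a where "a = real x * h"
  define b where "b = real (N - x) * h"
  have h: "0 < h" and u: "u = a" "1 - u = b" "0 < a" "0 < b" "a \<in> {0..1}"
    using x by (auto simp: h_def u_def a_def b_def field_simps)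
  have M0: "0 \<le> M2" "0 \<le> M1"
    using M1[of 0] M2[of 0] by auto
  define fp where "fp t = (G (u + t) - G u - G1 u * t) * t powr (- 1 - \<gamma>)" for t
  define fm where "fm t = (G (u - t) - G u + G1 u * t) * t powr (- 1 - \<gamma>)" for t
  define p where "p t = t powr (- \<gamma>)" for t :: real
  have p: "t * t powr (- 1 - \<gamma>) = p t" if "0 < t" for t
  proof -
    have "t * t powr (- 1 - \<gamma>) = t powr 1 * t powr (- 1 - \<gamma>)"
      using that by simp
    also have "\<dots> = p t"
      unfolding p_def by (simp only: powr_add[symmetric]) simp
    finally show ?thesis .
  qed
  \<comment> \<open>The linear Taylor terms enter with opposite signs on the two sides, which is
    what lets them cancel.\<close>
  have splitp: "(G (u + t) - G u) * t powr (- 1 - \<gamma>) = fp t + G1 u * p t"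
    and splitm: "(G (u - t) - G u) * t powr (- 1 - \<gamma>) = fm t - G1 u * p t" if "0 < t" for t
    unfolding p[OF that, symmetric] fp_def fm_def by (simp_all add: algebra_simps)

  have "h powr (2 - \<gamma>) = real N powr (\<gamma> - 2)" and hN1: "h powr (1 - \<gamma>) = real N powr (\<gamma> - 1)"
    using x by (simp_all add: h_def powr_divide powr_diff field_simps)
  then have err: "h powr (2 - \<gamma>) * (\<Sum>k=1..N. real k powr (- \<gamma>)) = riemann_err \<gamma> N"
    by (simp add: riemann_err_def)
  \<comment> \<open>One statement for both sides: \<open>c = 1\<close> looks to the right of
    \<open>u\<close> and \<open>c = - 1\<close> to the left. The second derivative acquires
    \<open>c * c = 1\<close>, so the bound \<open>M2\<close> is kept.\<close>
  have side: "\<bar>h * (\<Sum>k=1..<n. f (real k * h)) - integral {0..real n * h} f\<bar> \<le> M2 * (4 + 1 / (2 - \<gamma>)) * riemann_err \<gamma> N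
      \<and> f integrable_on {0..real n * h}"
    if f: "f = (\<lambda>t. (G (u + c * t) - G (u + c * 0) - G1 (u + c * 0) * c * t) * t powr (- 1 - \<gamma>))"
      and c: "\<bar>c\<bar> = 1" and range: "\<And>t. t \<in> {0..real n * h} \<Longrightarrow> u + c * t \<in> {0..1}"
      and n: "1 \<le> n" "n \<le> N" for f c n
  proof -
    have "((\<lambda>s. G (u + c * s)) has_real_derivative G1 (u + c * t) * c) (at t within {0..real n * h})"
      if "t \<in> {0..real n * h}" for t
      by (rule has_real_derivative_affine_within[OF G[OF range[OF that]]]) (use range in blast)
    moreover have "((\<lambda>s. G1 (u + c * s) * c) has_real_derivative G2 (u + c * t) * c * c) (at t within {0..real n * h})"
      if "t \<in> {0..real n * h}" for t
      by (rule DERIV_cmult_right[OF has_real_derivative_affine_within[OF G1[OF range[OF that]]]]) (use range in blast)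
    moreover have "\<bar>G2 (u + c * t) * c * c\<bar> \<le> M2" if "t \<in> {0..real n * h}" for t
      using M2[OF range[OF that]] c by (simp add: abs_mult)
    ultimately show ?thesis
      unfolding f err[symmetric]
      by (intro conjI taylor_remainder_riemann_sum_error[OF \<gamma> M0(1) h n]
        taylor_remainder_powr_integrable[OF \<gamma> M0(1)])
  qed
  have rangep: "u + 1 * t \<in> {0..1}" if "t \<in> {0..real (N - x) * h}" for t
    using that u unfolding b_def[symmetric] by auto
  have rangem: "u + (- 1) * t \<in> {0..1}" if "t \<in> {0..real x * h}" for t
    using that u unfolding a_def[symmetric] by auto
  have sidep: "\<bar>h * (\<Sum>k=1..<N - x. fp (real k * h)) - integral {0..b} fp\<bar> \<le> M2 * (4 + 1 / (2 - \<gamma>)) * riemann_err \<gamma> N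
      \<and> fp integrable_on {0..b}"
    unfolding b_def by (rule side[OF _ _ rangep]) (use x in \<open>auto simp: fp_def\<close>)
  have sidem: "\<bar>h * (\<Sum>k=1..<x. fm (real k * h)) - integral {0..a} fm\<bar> \<le> M2 * (4 + 1 / (2 - \<gamma>)) * riemann_err \<gamma> N
      \<and> fm integrable_on {0..a}"
    unfolding a_def by (rule side[OF _ _ rangem]) (use x in \<open>auto simp: fm_def\<close>)
  note errp = conjunct1[OF sidep] and intp = conjunct2[OF sidep]
    and errm = conjunct1[OF sidem] and intm = conjunct2[OF sidem]

  \<comment> \<open>\<open>\<epsilon>0\<close> is the distance from \<open>u\<close> to the nearer
    endpoint. One of the two integrals in \<open>K\<close> is over a single point, so
    \<open>G1 u * K\<close> is the linear contribution of the longer side beyond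
    \<open>\<epsilon>0\<close>.\<close>
  define \<epsilon>0 where "\<epsilon>0 = min a b"
  define K where "K = integral {\<epsilon>0..b} p - integral {\<epsilon>0..a} p"
  define L where "L = integral {0..b} fp + integral {0..a} fm + G1 u * K"
  have \<epsilon>0: "0 < \<epsilon>0" "\<epsilon>0 \<le> a" "\<epsilon>0 \<le> b"
    using u by (auto simp: \<epsilon>0_def)
  have p_int: "p integrable_on {s..t}" if "0 < s" for s t
    using powr_integrable_on_pos[OF that] by (simp add: p_def[abs_def])
  \<comment> \<open>The pieces of the integral of \<open>p\<close> over
    \<open>{\<epsilon>..\<epsilon>0}\<close> cancel between the sides; \<open>\<epsilon>\<close>
    survives only in the integrals of the remainders.\<close>
  have trunc: "truncated_integral \<gamma> G u \<epsilon> = integral {\<epsilon>..b} fp + integral {\<epsilon>..a} fm + G1 u * K"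
    if \<epsilon>: "0 < \<epsilon>" "\<epsilon> < \<epsilon>0" for \<epsilon>
  proof -
    have "continuous_on {0..1} G"
      unfolding continuous_on_eq_continuous_within using DERIV_continuous[OF G] by blast
    then have "truncated_integral \<gamma> G u \<epsilon>
      = integral {\<epsilon>..b} (\<lambda>t. (G (u + t) - G u) * t powr (- 1 - \<gamma>))
        + integral {\<epsilon>..a} (\<lambda>t. (G (u - t) - G u) * t powr (- 1 - \<gamma>))"
      using truncated_integral_eq[of G \<epsilon> u \<gamma>] \<epsilon> \<epsilon>0 u by simp
    also have "integral {\<epsilon>..b} (\<lambda>t. (G (u + t) - G u) * t powr (- 1 - \<gamma>)) = integral {\<epsilon>..b} (\<lambda>t. fp t + G1 u * p t)"
      using \<epsilon> by (intro Henstock_Kurzweil_Integration.integral_cong splitp) auto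
    also have "\<dots> = integral {\<epsilon>..b} fp + G1 u * integral {\<epsilon>..b} p"
      using \<epsilon> integrable_subinterval_real[OF intp, of \<epsilon> b] p_int
      by (subst Henstock_Kurzweil_Integration.integral_add) (auto intro: integrable_on_mult_right)
    also have "integral {\<epsilon>..a} (\<lambda>t. (G (u - t) - G u) * t powr (- 1 - \<gamma>)) = integral {\<epsilon>..a} (\<lambda>t. fm t - G1 u * p t)"
      using \<epsilon> by (intro Henstock_Kurzweil_Integration.integral_cong splitm) auto
    also have "\<dots> = integral {\<epsilon>..a} fm - G1 u * integral {\<epsilon>..a} p"
      using \<epsilon> integrable_subinterval_real[OF intm, of \<epsilon> a] p_int
      by (subst Henstock_Kurzweil_Integration.integral_diff) (auto intro: integrable_on_mult_right)
    also have "integral {\<epsilon>..b} p = integral {\<epsilon>..\<epsilon>0} p + integral {\<epsilon>0..b} p"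
      using \<epsilon> \<epsilon>0 p_int by (intro Henstock_Kurzweil_Integration.integral_combine[symmetric]) auto
    also have "integral {\<epsilon>..a} p = integral {\<epsilon>..\<epsilon>0} p + integral {\<epsilon>0..a} p"
      using \<epsilon> \<epsilon>0 p_int by (intro Henstock_Kurzweil_Integration.integral_combine[symmetric]) auto
    finally show ?thesis
      by (simp add: K_def algebra_simps)
  qed
  \<comment> \<open>The remainders are integrable up to \<open>0\<close>, so continuity of the
    integral in its lower limit gives the principal value \<open>L\<close>.\<close>
  have lim: "((\<lambda>\<epsilon>. integral {\<epsilon>..c} f) \<longlongrightarrow> integral {0..c} f) (at_right 0)"
    if "f integrable_on {0..c}" "0 < c" for f :: "real \<Rightarrow> real" and c
    using continuous_on_Icc_at_rightD[OF indefinite_integral_continuous_1'[OF that(1)] that(2)] .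
  have "((\<lambda>\<epsilon>. integral {\<epsilon>..b} fp + integral {\<epsilon>..a} fm + G1 u * K) \<longlongrightarrow> L) (at_right 0)"
    unfolding L_def using u by (intro tendsto_intros lim intp intm)
  moreover have "\<forall>\<^sub>F \<epsilon> in at_right 0. integral {\<epsilon>..b} fp + integral {\<epsilon>..a} fm + G1 u * K = truncated_integral \<gamma> G u \<epsilon>"
    using eventually_at_right_real[OF \<epsilon>0(1)] by (rule eventually_mono) (use trunc in auto)
  ultimately have "(truncated_integral \<gamma> G u \<longlongrightarrow> L) (at_right 0)"
    by (rule Lim_transform_eventually)
  then have L: "regional_frac_laplacian \<gamma> G u = c_gamma \<gamma> * L"
    unfolding regional_frac_laplacian_def by (subst tendsto_Lim) auto

  define P where "P n = h * (\<Sum>k=1..<n. p (real k * h))" for n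
  have sump: "h * (\<Sum>k=1..<N - x. (G (u + real k * h) - G u) * (real k * h) powr (- 1 - \<gamma>))
      = h * (\<Sum>k=1..<N - x. fp (real k * h)) + G1 u * P (N - x)"
  proof -
    have "(\<Sum>k=1..<N - x. (G (u + real k * h) - G u) * (real k * h) powr (- 1 - \<gamma>))
      = (\<Sum>k=1..<N - x. fp (real k * h) + G1 u * p (real k * h))"
      using h by (intro sum.cong splitp) auto
    then show ?thesis
      by (simp add: P_def sum.distrib distrib_left sum_distrib_left mult_ac)
  qed
  have summ: "h * (\<Sum>k=1..<x. (G (u - real k * h) - G u) * (real k * h) powr (- 1 - \<gamma>))
      = h * (\<Sum>k=1..<x. fm (real k * h)) - G1 u * P x"
  proof -
    have "(\<Sum>k=1..<x. (G (u - real k * h) - G u) * (real k * h) powr (- 1 - \<gamma>))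
      = (\<Sum>k=1..<x. fm (real k * h) - G1 u * p (real k * h))"
      using h by (intro sum.cong splitm) auto
    then show ?thesis
      by (simp add: P_def sum_subtractf right_diff_distrib sum_distrib_left mult_ac)
  qed
  \<comment> \<open>The cutoff is taken to be \<open>\<epsilon>0\<close>, which makes the difference
    of integrals exactly \<open>K\<close>.\<close>
  have "\<bar>P (N - x) - P x - K\<bar> \<le> h powr (1 - \<gamma>) * (real x powr (- \<gamma>) + real (N - x) powr (- \<gamma>))"
    unfolding P_def K_def p_def a_def b_def
    using x \<epsilon>0 unfolding a_def b_def by (intro powr_riemann_sum_difference_error \<gamma> h) auto
  then have errK: "\<bar>G1 u * (P (N - x) - P x - K)\<bar> \<le> M1 * (real N powr (\<gamma> - 1) * (real x powr (- \<gamma>) + real (N - x) powr (- \<gamma>)))"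
    unfolding abs_mult hN1 using M1[of u] u by (intro mult_mono) auto
  have "real N powr \<gamma> * discrete_gen \<gamma> N G (int x) - regional_frac_laplacian \<gamma> G u
    = c_gamma \<gamma> * ((h * (\<Sum>k=1..<N - x. fp (real k * h)) - integral {0..b} fp)
        + (h * (\<Sum>k=1..<x. fm (real k * h)) - integral {0..a} fm) + G1 u * (P (N - x) - P x - K))"
    using discrete_gen_eq[OF x, of \<gamma> G] unfolding L h_def[symmetric] u_def[symmetric] sump summ L_def
    by (simp add: algebra_simps)
  also have "\<bar>\<dots>\<bar> \<le> \<bar>c_gamma \<gamma>\<bar> * (2 * M2 * (4 + 1 / (2 - \<gamma>)) * riemann_err \<gamma> N
        + M1 * (real N powr (\<gamma> - 1) * (real x powr (- \<gamma>) + real (N - x) powr (- \<gamma>))))"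
    unfolding abs_mult
  proof (rule mult_left_mono)
    have "2 * M2 * (4 + 1 / (2 - \<gamma>)) * riemann_err \<gamma> N = 2 * (M2 * (4 + 1 / (2 - \<gamma>)) * riemann_err \<gamma> N)"
      by (simp only: mult.assoc)
    then show "\<bar>(h * (\<Sum>k=1..<N - x. fp (real k * h)) - integral {0..b} fp)
        + (h * (\<Sum>k=1..<x. fm (real k * h)) - integral {0..a} fm) + G1 u * (P (N - x) - P x - K)\<bar>
      \<le> 2 * M2 * (4 + 1 / (2 - \<gamma>)) * riemann_err \<gamma> N
        + M1 * (real N powr (\<gamma> - 1) * (real x powr (- \<gamma>) + real (N - x) powr (- \<gamma>)))"
      using errp errm errK by linarith
  qed simp
  finally show ?thesis
    unfolding u_def .
qed

section \<open>Averaging over the lattice\<close>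

theorem lemma5p1:
  fixes G :: "real \<Rightarrow> real" and \<gamma> :: real
  assumes "smooth_unit_interval G" and "0 < \<gamma>" and "\<gamma> < 2"
  shows "(\<lambda>N :: nat. inverse (real N) *
            (\<Sum>x\<in>lattice N.
               \<bar>real N powr \<gamma> * discrete_gen \<gamma> N G x
                 - regional_frac_laplacian \<gamma> G (of_int x / real N)\<bar>))
         \<longlonglongrightarrow> 0"
proof -
  obtain D :: "nat \<Rightarrow> real \<Rightarrow> real" where D0: "\<And>u. u \<in> {0..1} \<Longrightarrow> D 0 u = G u"
    and D: "\<And>n u. u \<in> {0..1} \<Longrightarrow> (D n has_real_derivative D (Suc n) u) (at u within {0..1})"
    using assms(1) unfolding smooth_unit_interval_def by blast
  have bounded: "\<exists>M. \<forall>u\<in>{0..1}. \<bar>D n u\<bar> \<le> M" for n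
  proof -
    have "continuous_on {0..1} (D n)"
      unfolding continuous_on_eq_continuous_within using DERIV_continuous[OF D] by blast
    then have "bounded (D n ` {0..1})"
      by (intro compact_imp_bounded compact_continuous_image) auto
    then show ?thesis
      unfolding bounded_iff by auto
  qed
  obtain M1 M2 where M1: "\<And>u. u \<in> {0..1} \<Longrightarrow> \<bar>D 1 u\<bar> \<le> M1" and M2: "\<And>u. u \<in> {0..1} \<Longrightarrow> \<bar>D 2 u\<bar> \<le> M2"
    using bounded[of 1] bounded[of 2] by blast
  \<comment> \<open>\<open>G\<close> is known to equal \<open>D 0\<close> only on the interval,
    which suffices for derivatives within it; the radius \<open>1\<close> is arbitrary.\<close>
  have G: "(G has_real_derivative D 1 u) (at u within {0..1})" if "u \<in> {0..1}" for u
    using has_field_derivative_transform_within[OF D[OF that, of 0] zero_less_one that, of G] D0 by simp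
  have D1: "(D 1 has_real_derivative D 2 u) (at u within {0..1})" if "u \<in> {0..1}" for u
    using D[OF that, of 1] by (simp add: numeral_2_eq_2)
  \<comment> \<open>\<open>A\<close> is the coefficient of \<open>riemann_err\<close> at a single
    site; the \<open>2 * M1\<close> in \<open>C\<close> is what the powers from the two endpoints
    contribute after averaging.\<close>
  define A where "A = 2 * M2 * (4 + 1 / (2 - \<gamma>))"
  define C where "C = \<bar>c_gamma \<gamma>\<bar> * (A + 2 * M1)"
  define err where "err N x = \<bar>real N powr \<gamma> * discrete_gen \<gamma> N G x - regional_frac_laplacian \<gamma> G (of_int x / real N)\<bar>"
    for N x
  have A0: "0 \<le> A" and M10: "0 \<le> M1"
    using M1[of 0] M2[of 0] assms(3) by (auto simp: A_def)
  have R0: "0 \<le> riemann_err \<gamma> N" for N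
    unfolding riemann_err_def by (intro mult_nonneg_nonneg sum_nonneg) auto
  have bound: "inverse (real N) * (\<Sum>x\<in>lattice N. err N x) \<le> C * riemann_err \<gamma> N" if N: "1 \<le> N" for N
  proof -
    let ?S = "\<Sum>k=1..<N. real k powr (- \<gamma>)"
    have "lattice N = int ` {1..<N}"
      by (auto simp: lattice_def image_int_atLeastLessThan)
    then have "(\<Sum>x\<in>lattice N. err N x) = (\<Sum>x=1..<N. err N (int x))"
      by (simp add: sum.reindex)
    also have "\<dots> \<le> (\<Sum>x=1..<N. \<bar>c_gamma \<gamma>\<bar> * (A * riemann_err \<gamma> N
        + M1 * (real N powr (\<gamma> - 1) * (real x powr (- \<gamma>) + real (N - x) powr (- \<gamma>)))))"
      unfolding A_def err_def
      by (intro sum_mono) (use discretization_error[OF assms(2,3) G D1 M1 M2] in auto)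
    also have "\<dots> = \<bar>c_gamma \<gamma>\<bar> * (real (N - 1) * (A * riemann_err \<gamma> N)
        + M1 * (real N powr (\<gamma> - 1) * (?S + (\<Sum>x=1..<N. real (N - x) powr (- \<gamma>)))))"
      by (simp add: sum.distrib flip: sum_distrib_left)
    \<comment> \<open>Reflecting the lattice identifies the contributions of the two
      endpoints.\<close>
    also have "(\<Sum>x=1..<N. real (N - x) powr (- \<gamma>)) = ?S"
      by (rule sum.reindex_bij_witness[of _ "\<lambda>x. N - x" "\<lambda>x. N - x"]) auto
    also have "\<bar>c_gamma \<gamma>\<bar> * (real (N - 1) * (A * riemann_err \<gamma> N) + M1 * (real N powr (\<gamma> - 1) * (?S + ?S)))
        \<le> \<bar>c_gamma \<gamma>\<bar> * (real N * (A * riemann_err \<gamma> N) + M1 * (2 * real N * riemann_err \<gamma> N))"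
    proof (intro mult_left_mono add_mono mult_right_mono)
      \<comment> \<open>Splitting off one factor \<open>N\<close> bounds the summed endpoint errors
        by a multiple of \<open>N * riemann_err \<gamma> N\<close>, and the averaging factor
        \<open>inverse (real N)\<close> removes it. Errors that are not small near the endpoints are
        thus small on average.\<close>
      have "real N powr (\<gamma> - 1) = real N powr 1 * real N powr (\<gamma> - 2)"
        by (simp only: powr_add[symmetric]) simp
      then have "real N powr (\<gamma> - 1) * (?S + ?S) = 2 * real N * (real N powr (\<gamma> - 2) * ?S)"
        using N by simp
      also have "\<dots> \<le> 2 * real N * riemann_err \<gamma> N"
        unfolding riemann_err_def by (intro mult_left_mono sum_mono2) auto
      finally show "real N powr (\<gamma> - 1) * (?S + ?S) \<le> 2 * real N * riemann_err \<gamma> N" .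
    qed (use A0 R0 M10 in auto)
    also have "\<dots> = real N * (C * riemann_err \<gamma> N)"
      by (simp add: C_def algebra_simps)
    finally show ?thesis
      using N by (simp add: field_simps)
  qed
  have "(\<lambda>N. inverse (real N) * (\<Sum>x\<in>lattice N. err N x)) \<longlonglongrightarrow> 0"
  proof (rule tendsto_sandwich[OF _ _ tendsto_const])
    show "\<forall>\<^sub>F N in sequentially. 0 \<le> inverse (real N) * (\<Sum>x\<in>lattice N. err N x)"
      by (intro always_eventually allI mult_nonneg_nonneg sum_nonneg) (auto simp: err_def)
    show "\<forall>\<^sub>F N in sequentially. inverse (real N) * (\<Sum>x\<in>lattice N. err N x) \<le> C * riemann_err \<gamma> N"
      using eventually_ge_at_top[of 1] by eventually_elim (rule bound)
    show "(\<lambda>N. C * riemann_err \<gamma> N) \<longlonglongrightarrow> 0"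
      by (intro tendsto_mult_right_zero riemann_err_tendsto_0 assms)
  qed
  then show ?thesis
    by (simp add: err_def)
qed

end
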